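(* (1) For every non-negative integer $n$ and all non-negative integers $a_0,\ldots,a_n$ such that $a_i\neq a_j$ for all $i,j\le n$ with $i\ne j$, there exists a short impartial game $G$ such that $g_G(i)=a_i$ for all $0\le i\leq n$. (2) For every non-negative integer $n$ and all non-negative integers $a_0,\ldots,a_n$ such that $a_i\neq a_j$ for all $i,j\le n$ with $i\ne j$, there exists a short impartial game $G$ such that $s_G(i)=a_i$ for all $0\le i\leq n$.
   Context: All games are short impartial games under normal play (a player unable to move loses): a position is identified with its finite set of options, which are themselves short impartial games; there are no infinite plays. The empty game (no options) is denoted $0$. $G\equiv H$ means that $G$ and $H$ have the same option sets (are identical as games). $G+H$ is the disjunctive sum. $G=0$ means that $G$ is a $\mathcal P$-position, i.e. the previous player (the player not about to move) has a winning strategy. The nimber $*n$ is the game with options $*k$, $0\le k<n$ ($*0\equiv 0$). The split sum $G\circ H$ is defined recursively by: $G\circ H\equiv 0$ if $G\equiv 0$; $G\circ H\equiv G$ if $H\equiv 0$; and otherwise $G\circ H\equiv\{G\circ h,\ g\circ H\}$, where $g$ ranges over the options of $G$ and $h$ over the options of $H$. Extended Grundy function: for a game $G$ and a non-negative integer $n$, $g_G(n)$ is the non-negative integer (which exists and is unique) such that $(G+*g_G(n))\circ *n=0$. Extended split function: $s_G(n)$ is the non-negative integer, if it exists and is unique, such that $(G+*n)\circ *s_G(n)=0$; if such an integer does not exist or is not unique, $s_G(n)=\infty$. *)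

theory Defs
  imports Main "HOL-Library.FSet" "HOL-Library.Extended_Nat"
begin

text \<open>Short impartial games: a game is its finite set of options, so equality of the
  datatype is identity of games (\<open>\<equiv>\<close>), and there are no infinite plays.\<close>

datatype game = Game (options: "game fset")

definition zero_game :: game where
  "zero_game = Game {||}"

lemma size_option [termination_simp]: "g |\<in>| options G \<Longrightarrow> size g < size G"
proof (cases G)
  case (Game X)
  assume "g |\<in>| options G"
  then have "Suc (size g) \<le> (\<Sum>x\<in>fset X. Suc (size x))"
    using Game by (intro member_le_sum) auto
  then show ?thesis using Game by (simp add: size_fset_simps)
qed

text \<open>Normal play: \<open>second_wins \<sigma> G\<close> says that the player not about to move wins \<open>G\<close> by
  answering every move to a position \<open>H\<close> with the move to \<open>\<sigma> H\<close>.  The base case is hidden in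
  the bounded quantifier: a player facing a game without options loses.\<close>

inductive second_wins :: "(game \<Rightarrow> game) \<Rightarrow> game \<Rightarrow> bool" for \<sigma> where
  "(\<And>H. H |\<in>| options G \<Longrightarrow> \<sigma> H |\<in>| options H \<and> second_wins \<sigma> (\<sigma> H)) \<Longrightarrow> second_wins \<sigma> G"

definition P_position :: "game \<Rightarrow> bool" where
  "P_position G \<longleftrightarrow> (\<exists>\<sigma>. second_wins \<sigma> G)"

function game_sum :: "game \<Rightarrow> game \<Rightarrow> game" where
  "game_sum G H =
     Game ((\<lambda>g. game_sum g H) |`| options G |\<union>| (\<lambda>h. game_sum G h) |`| options H)"
  by pat_completeness auto
termination
  by (relation "measure (\<lambda>(G, H). size G + size H)") (auto dest: size_option)

function split_sum :: "game \<Rightarrow> game \<Rightarrow> game" where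
  "split_sum G H =
     (if G = zero_game then zero_game
      else if H = zero_game then G
      else Game ((\<lambda>h. split_sum G h) |`| options H |\<union>| (\<lambda>g. split_sum g H) |`| options G))"
  by pat_completeness auto
termination
  by (relation "measure (\<lambda>(G, H). size G + size H)") (auto dest: size_option)

declare game_sum.simps [simp del] split_sum.simps [simp del]

fun nimber :: "nat \<Rightarrow> game" where
  "nimber n = Game (fset_of_list (map nimber [0..<n]))"

declare nimber.simps [simp del]

definition grundy_ext :: "game \<Rightarrow> nat \<Rightarrow> nat" where
  "grundy_ext G n = (THE m. P_position (split_sum (game_sum G (nimber m)) (nimber n)))"

definition split_ext :: "game \<Rightarrow> nat \<Rightarrow> enat" where
  "split_ext G n =
     (if \<exists>!m. P_position (split_sum (game_sum G (nimber n)) (nimber m))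
      then enat (THE m. P_position (split_sum (game_sum G (nimber n)) (nimber m)))
      else \<infinity>)"

lemma P_position_iff: "P_position G \<longleftrightarrow> (\<forall>H. H |\<in>| options G \<longrightarrow> \<not> P_position H)"
proof -
  define good where "good = rec_game (\<lambda>S. \<forall>p. p |\<in>| S \<longrightarrow> \<not> snd p)"
  have good: "good G \<longleftrightarrow> (\<forall>H. H |\<in>| options G \<longrightarrow> \<not> good H)" for G
  proof (cases G)
    case (Game X)
    have "good (Game X) \<longleftrightarrow> (\<forall>p. p |\<in>| (\<lambda>g. (g, good g)) |`| X \<longrightarrow> \<not> snd p)"
      unfolding good_def by (subst game.rec) (rule refl)
    then show ?thesis using Game by auto
  qed
  define \<sigma> where "\<sigma> H = (SOME K. K |\<in>| options H \<and> good K)" for H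
  have 1: "good G" if "second_wins \<tau> G" for G \<tau>
    using that by induction (insert good, blast)
  have 2: "good G \<Longrightarrow> second_wins \<sigma> G" for G
  proof (induction "size G" arbitrary: G rule: less_induct)
    case less
    show ?case
    proof (rule second_wins.intros)
      fix H assume H: "H |\<in>| options G"
      then have "\<exists>K. K |\<in>| options H \<and> good K" using less.prems good by blast
      then have "\<sigma> H |\<in>| options H \<and> good (\<sigma> H)" unfolding \<sigma>_def by (rule someI_ex)
      then show "\<sigma> H |\<in>| options H \<and> second_wins \<sigma> (\<sigma> H)"
        using less.hyps[of "\<sigma> H"] size_option[of "\<sigma> H" H] size_option[OF H] by auto
    qed
  qed
  have "P_position G \<longleftrightarrow> good G" for G
    using 1 2 unfolding P_position_def by blast
  then show ?thesis using good by blast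
qed

lemma options_nimber: "h |\<in>| options (nimber n) \<longleftrightarrow> (\<exists>k<n. h = nimber k)"
  by (subst nimber.simps) (auto simp: fset_of_list_elem)

lemma options_game_sum:
  "x |\<in>| options (game_sum G H) \<longleftrightarrow>
     (\<exists>g. g |\<in>| options G \<and> x = game_sum g H) \<or> (\<exists>h. h |\<in>| options H \<and> x = game_sum G h)"
  by (subst game_sum.simps) auto

text \<open>The description defining \<open>grundy_ext\<close> always denotes.\<close>

lemma grundy_ext_ex1: "\<exists>!m. P_position (split_sum (game_sum G (nimber m)) (nimber n))"
proof (induction "size G + n" arbitrary: G n rule: less_induct)
  case less
  let ?f = "\<lambda>G m n. split_sum (game_sum G (nimber m)) (nimber n)"
  have opt0: "x |\<in>| options (?f G m n) \<Longrightarrow>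
      (\<exists>g. g |\<in>| options G \<and> x = ?f g m n) \<or> (\<exists>k<m. x = ?f G k n) \<or> (\<exists>k<n. x = ?f G m k)"
    for x m
  proof -
    assume x: "x |\<in>| options (?f G m n)"
    show ?thesis
    proof (cases "nimber n = zero_game")
      case True
      then have f: "?f G' m' n = game_sum G' (nimber m')" for G' m'
        by (simp add: split_sum.simps)
      from x show ?thesis unfolding f by (auto simp: options_game_sum options_nimber)
    next
      case False
      have nz: "game_sum G (nimber m) \<noteq> zero_game"
        using x by (auto simp: split_sum.simps zero_game_def)
      from x False nz have "(\<exists>h. h |\<in>| options (nimber n) \<and> x = split_sum (game_sum G (nimber m)) h) \<or>
          (\<exists>g. g |\<in>| options (game_sum G (nimber m)) \<and> x = split_sum g (nimber n))"
        by (subst (asm) split_sum.simps) auto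
      then show ?thesis unfolding options_game_sum options_nimber by blast
    qed
  qed
  have down: "?f G k n |\<in>| options (?f G m n)" if "k < m" for k m
  proof -
    have o: "game_sum G (nimber k) |\<in>| options (game_sum G (nimber m))"
      using that by (auto simp: options_game_sum options_nimber)
    then have nz: "game_sum G (nimber m) \<noteq> zero_game" by (auto simp: zero_game_def)
    show ?thesis
    proof (cases "nimber n = zero_game")
      case True
      then show ?thesis using o nz by (auto simp: split_sum.simps)
    next
      case False
      then show ?thesis using o nz by (subst (2) split_sum.simps) auto
    qed
  qed
  have uniq: "m = m'" if "P_position (?f G m n)" "P_position (?f G m' n)" for m m'
    using that down[of m m'] down[of m' m] P_position_iff[of "?f G m n"] P_position_iff[of "?f G m' n"]
    by (meson linorder_neqE_nat)
  have "\<exists>m. P_position (?f G m n)"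
  proof (rule ccontr)
    assume no: "\<not> ?thesis"
    define B where "B = (\<lambda>g. THE m. P_position (?f g m n)) ` fset (options G)
                      \<union> (\<lambda>k. THE m. P_position (?f G m k)) ` {..<n}"
    have "m \<in> B" for m
    proof -
      obtain x where x: "x |\<in>| options (?f G m n)" "P_position x"
        using no P_position_iff by blast
      then consider g where "g |\<in>| options G" "x = ?f g m n" | k where "k < n" "x = ?f G m k"
        using opt0 no by blast
      then show ?thesis
      proof cases
        case 1
        have "\<exists>!m. P_position (?f g m n)" using less 1 size_option by simp
        then have "m = (THE m. P_position (?f g m n))" using x 1 by (simp add: the1_equality)
        then show ?thesis using 1 unfolding B_def by blast
      next
        case 2
        have "\<exists>!m. P_position (?f G m k)" using less 2 by simp
        then have "m = (THE m. P_position (?f G m k))" using x 2 by (simp add: the1_equality)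
        then show ?thesis using 2 unfolding B_def by blast
      qed
    qed
    then have "B = UNIV" by auto
    moreover have "finite B" unfolding B_def by simp
    ultimately show False by simp
  qed
  then show ?case using uniq by blast
qed

end

theory Submission
  imports Defs
begin

text \<open>
  For a game \<open>G \<noteq> 0\<close> and all \<open>n\<close>, the extended Grundy function satisfies a mex recursion:
  \<open>g\<^sub>G(n)\<close> is the least number outside
  \<open>{g\<^sub>H(n) | H an option of G} \<union> {g\<^sub>G(k) | k < n}\<close>.
  The recursion is split into \<open>grundy_ext_option_neq\<close>, \<open>grundy_ext_neq_earlier\<close> and
  \<open>grundy_ext_attained_below\<close>.  By it, a sequence \<open>a\<close> of distinct
  numbers is realised by every nonempty set of options which at each position \<open>j\<close> avoids \<open>a\<^sub>j\<close>
  and attains each smaller value that does not occur earlier in \<open>a\<close> (\<open>grundy_ext_realises\<close>).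

  It suffices to find, for each position \<open>i\<close> and each \<open>v < a\<^sub>i\<close>, one option with value \<open>v\<close> at \<open>i\<close>
  that avoids \<open>a\<close> everywhere.  These options are themselves obtained by realising
  sequences; the other entries may be chosen as large as we like, so the induction cannot be on
  the size of the entries.  It is on the length of the sequence, and for a fixed length on the last
  entry \<open>c\<close> alone.  Thus we may prescribe either only the entries before the last one, or all
  entries provided that the last one is below \<open>c\<close>.  In the first case the value at the last
  position must still be kept away from \<open>c\<close>.  Two devices do this: since \<open>g\<^sub>G\<close> is injective, it
  suffices that \<open>c\<close> is among the earlier values; and a game with the option \<open>0\<close> never takes the
  value \<open>0\<close>.  In one remaining case the option is the game \<open>0\<close> itself
  (\<open>exists_option_for\<close>).

  For the split function, \<open>g\<^sub>G\<close> is injective for \<open>G \<noteq> 0\<close>, so \<open>s\<^sub>G\<close> is its partial inverse.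
  Prescribing \<open>s\<^sub>G(i) = a\<^sub>i\<close> means prescribing \<open>g\<^sub>G(a\<^sub>i) = i\<close>, and the remaining values of
  \<open>g\<^sub>G\<close> on an initial segment can be filled with large distinct numbers.
\<close>

section \<open>The mex recursion of the extended Grundy function\<close>

abbreviation nim_split :: "game \<Rightarrow> nat \<Rightarrow> nat \<Rightarrow> game" where
  "nim_split G m n \<equiv> split_sum (game_sum G (nimber m)) (nimber n)"

lemma nonzero_iff: "G \<noteq> zero_game \<longleftrightarrow> (\<exists>g. g |\<in>| options G)"
  by (cases G) (auto simp: zero_game_def)

lemma nimber_nonzero_iff: "nimber n \<noteq> zero_game \<longleftrightarrow> 0 < n"
  unfolding nonzero_iff options_nimber by auto

lemma nimber_0: "nimber 0 = zero_game"
  using nimber_nonzero_iff by blast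

lemma grundy_ext_eq_iff: "grundy_ext G n = m \<longleftrightarrow> P_position (nim_split G m n)"
  unfolding grundy_ext_def using theI'[OF grundy_ext_ex1] the1_equality[OF grundy_ext_ex1] by blast

text \<open>Once \<open>G \<noteq> 0\<close>, the base cases of the split sum do not disturb the moves: the left summand
  is never empty, and for \<open>n = 0\<close> the split sum is \<open>G + *m\<close> and there is no \<open>k < n\<close>.  The case
  \<open>n > 0\<close> includes the move to \<open>*0\<close>, which leaves \<open>G + *m\<close>.\<close>

lemma options_nim_split:
  assumes "G \<noteq> zero_game"
  shows "x |\<in>| options (nim_split G m n) \<longleftrightarrow>
    (\<exists>g. g |\<in>| options G \<and> x = nim_split g m n) \<or>
    (\<exists>k<m. x = nim_split G k n) \<or> (\<exists>k<n. x = nim_split G m k)"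
proof -
  have sum_nz: "game_sum G (nimber m) \<noteq> zero_game"
    using assms unfolding nonzero_iff options_game_sum by blast
  show ?thesis
  proof (cases "n = 0")
    case True
    then have "nim_split H l n = game_sum H (nimber l)" for H l
      by (simp add: split_sum.simps nimber_0)
    then show ?thesis using True by (auto simp: options_game_sum options_nimber)
  next
    case False
    then have "nimber n \<noteq> zero_game" by (simp add: nimber_nonzero_iff)
    then have "x |\<in>| options (nim_split G m n) \<longleftrightarrow>
        (\<exists>h. h |\<in>| options (nimber n) \<and> x = split_sum (game_sum G (nimber m)) h) \<or>
        (\<exists>g. g |\<in>| options (game_sum G (nimber m)) \<and> x = split_sum g (nimber n))"
      using sum_nz by (subst split_sum.simps) auto
    then show ?thesis unfolding options_game_sum options_nimber by blast
  qed
qed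

lemma grundy_ext_zero [simp]: "grundy_ext zero_game n = 0"
proof -
  have "game_sum zero_game (nimber 0) = zero_game"
    using nonzero_iff by (metis options_game_sum nimber_0)
  then show ?thesis
    unfolding grundy_ext_eq_iff
    by (subst P_position_iff) (simp add: split_sum.simps zero_game_def)
qed

lemma grundy_ext_option_neq:
  assumes "H |\<in>| options G"
  shows "grundy_ext H n \<noteq> grundy_ext G n"
  using assms grundy_ext_eq_iff P_position_iff options_nim_split nonzero_iff by metis

lemma grundy_ext_neq_earlier:
  assumes "G \<noteq> zero_game" "k < n"
  shows "grundy_ext G k \<noteq> grundy_ext G n"
  using assms grundy_ext_eq_iff P_position_iff options_nim_split by metis

lemma grundy_ext_inj:
  assumes "G \<noteq> zero_game"
  shows "inj (grundy_ext G)"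
  using grundy_ext_neq_earlier[OF assms] by (intro linorder_injI)

text \<open>The position \<open>(G + *v) \<circ> *n\<close> is not a P-position, so it has a winning move.  A move in \<open>G\<close>
  or in \<open>*n\<close> gives one of the two alternatives.  A winning move to some \<open>*k\<close> in \<open>*v\<close> would mean
  \<open>g\<^sub>G(n) = k < v\<close>.\<close>

lemma grundy_ext_attained_below:
  assumes "G \<noteq> zero_game" "v < grundy_ext G n"
  shows "(\<exists>H. H |\<in>| options G \<and> grundy_ext H n = v) \<or> (\<exists>k<n. grundy_ext G k = v)"
proof -
  have "\<not> P_position (nim_split G v n)"
    using assms(2) by (simp flip: grundy_ext_eq_iff)
  then obtain x where "x |\<in>| options (nim_split G v n)" "P_position x"
    using P_position_iff by blast
  then show ?thesis
    using assms(2) unfolding options_nim_split[OF assms(1)]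
    by (metis grundy_ext_eq_iff less_asym)
qed

section \<open>Realising a sequence by a set of options\<close>

lemma grundy_ext_realises:
  assumes nz: "G \<noteq> zero_game"
    and inj: "inj_on a {..<n}"
    and avoid: "\<And>H j. H |\<in>| options G \<Longrightarrow> j < n \<Longrightarrow> grundy_ext H j \<noteq> a j"
    and attain: "\<And>j v. j < n \<Longrightarrow> v < a j \<Longrightarrow> v \<notin> a ` {..<j} \<Longrightarrow>
      \<exists>H. H |\<in>| options G \<and> grundy_ext H j = v"
    and "i < n"
  shows "grundy_ext G i = a i"
  using \<open>i < n\<close>
proof (induction i rule: less_induct)
  case (less i)
  have earlier: "grundy_ext G k = a k" if "k < i" for k
    using less that by simp
  show ?case
  proof (rule linorder_cases)
    assume lt: "grundy_ext G i < a i"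
    have "grundy_ext G i \<notin> a ` {..<i}"
      using earlier grundy_ext_neq_earlier[OF nz] by fastforce
    then show ?thesis
      using attain[OF less.prems lt] grundy_ext_option_neq by blast
  next
    assume "a i < grundy_ext G i"
    then consider H where "H |\<in>| options G" "grundy_ext H i = a i"
      | k where "k < i" "grundy_ext G k = a i"
      using grundy_ext_attained_below[OF nz] by blast
    then show ?thesis
    proof cases
      case 1
      then show ?thesis using avoid less.prems by blast
    next
      case 2
      then have "a k = a i" using earlier by simp
      then show ?thesis
        using inj_onD[OF inj] 2(1) less.prems by fastforce
    qed
  qed
qed

text \<open>Inserting the option \<open>0\<close>, all of whose values are \<open>0\<close>, does not disturb positive values,
  but it excludes the value \<open>0\<close> at every later position.\<close>

lemma insert_zero_option:
  assumes nz: "G \<noteq> zero_game"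
    and pos: "\<And>j. j < n \<Longrightarrow> 0 < grundy_ext G j"
  obtains G' where "\<And>j. j < n \<Longrightarrow> grundy_ext G' j = grundy_ext G j"
    and "\<And>j. grundy_ext G' j \<noteq> 0"
proof
  let ?G = "Game (finsert zero_game (options G))"
  show "grundy_ext ?G j = grundy_ext G j" if "j < n" for j
  proof (rule grundy_ext_realises[of ?G "grundy_ext G" n])
    show "?G \<noteq> zero_game" by (simp add: zero_game_def)
    show "inj_on (grundy_ext G) {..<n}"
      using grundy_ext_inj[OF nz] by (rule inj_on_subset) simp
    show "grundy_ext H k \<noteq> grundy_ext G k" if "H |\<in>| options ?G" "k < n" for H k
      using that pos[of k] grundy_ext_option_neq by auto
    show "\<exists>H. H |\<in>| options ?G \<and> grundy_ext H k = v"
      if "v < grundy_ext G k" "v \<notin> grundy_ext G ` {..<k}" for k v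
      using grundy_ext_attained_below[OF nz that(1)] that(2) by auto
  qed fact
  show "grundy_ext ?G j \<noteq> 0" for j
    using grundy_ext_option_neq[of zero_game ?G j] by simp
qed

text \<open>At each position distinct nimbers have distinct values, so only finitely many of them meet
  a given finite sequence.  This supplies an option when the mex conditions demand none: the empty
  option set has to be avoided because \<open>0\<close> does not obey the recursion.\<close>

lemma exists_avoiding_game: "\<exists>G. \<forall>j<n. grundy_ext G j \<noteq> a j"
proof -
  have "grundy_ext (nimber k) j \<noteq> grundy_ext (nimber w) j" if "k < w" for k w j
    using that by (intro grundy_ext_option_neq) (auto simp: options_nimber)
  then have "inj (\<lambda>w. grundy_ext (nimber w) j)" for j
    by (intro linorder_injI)
  then have "finite ((\<lambda>w. grundy_ext (nimber w) j) -` {a j})" for j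
    by (intro finite_vimageI) auto
  then have "finite (\<Union>j<n. (\<lambda>w. grundy_ext (nimber w) j) -` {a j})"
    by (intro finite_UN_I) auto
  from ex_new_if_finite[OF infinite_UNIV_nat this]
  obtain w where "w \<notin> (\<Union>j<n. (\<lambda>w. grundy_ext (nimber w) j) -` {a j})" ..
  then show ?thesis by blast
qed

lemma realise_from_witnesses:
  assumes inj: "inj_on a {..<n}"
    and opt: "\<And>i v. i < n \<Longrightarrow> v < a i \<Longrightarrow> v \<notin> a ` {..<i} \<Longrightarrow>
      \<exists>H. grundy_ext H i = v \<and> (\<forall>j<n. grundy_ext H j \<noteq> a j)"
  shows "\<exists>G. G \<noteq> zero_game \<and> (\<forall>i<n. grundy_ext G i = a i)"
proof -
  define D where "D = (SIGMA i:{..<n}. {..<a i} - a ` {..<i})"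
  have "\<forall>p\<in>D. \<exists>H. grundy_ext H (fst p) = snd p \<and> (\<forall>j<n. grundy_ext H j \<noteq> a j)"
    using opt unfolding D_def by auto
  then obtain h where h: "grundy_ext (h p) (fst p) = snd p" "\<forall>j<n. grundy_ext (h p) j \<noteq> a j"
    if "p \<in> D" for p by metis
  obtain K where K: "\<forall>j<n. grundy_ext K j \<noteq> a j" using exists_avoiding_game by blast
  have "finite (insert K (h ` D))" unfolding D_def by auto
  then obtain S where S: "fset S = insert K (h ` D)"
    by (metis Abs_fset_inverse mem_Collect_eq)
  let ?G = "Game S"
  have nz: "?G \<noteq> zero_game" using S by (auto simp: zero_game_def)
  have "grundy_ext ?G i = a i" if "i < n" for i
  proof (rule grundy_ext_realises[OF nz inj _ _ that])
    show "grundy_ext H j \<noteq> a j" if "H |\<in>| options ?G" "j < n" for H j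
      using that S K h(2) by auto
    show "\<exists>H. H |\<in>| options ?G \<and> grundy_ext H j = v"
      if "j < n" "v < a j" "v \<notin> a ` {..<j}" for j v
    proof -
      have "(j, v) \<in> D" using that unfolding D_def by simp
      then show ?thesis using h(1)[of "(j, v)"] S by auto
    qed
  qed
  with nz show ?thesis by blast
qed

section \<open>Every finite sequence of distinct numbers is realised\<close>

text \<open>This is the induction step: \<open>shorter\<close> is the hypothesis for shorter sequences and
  \<open>smaller_last\<close> the one for sequences of the same length with a smaller last entry.
  Entries that do not matter are \<open>M + j\<close>, where \<open>M\<close> exceeds all of \<open>a\<close>.\<close>

lemma exists_option_for:
  assumes shorter: "\<And>b. inj_on b {..<n} \<Longrightarrow>
      \<exists>G. G \<noteq> zero_game \<and> (\<forall>j<n. grundy_ext G j = b j)"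
    and smaller_last: "\<And>b. inj_on b {..<Suc n} \<Longrightarrow> b n < a n \<Longrightarrow>
      \<exists>G. G \<noteq> zero_game \<and> (\<forall>j<Suc n. grundy_ext G j = b j)"
    and i: "i < Suc n" and v: "v < a i"
  shows "\<exists>H. grundy_ext H i = v \<and> (\<forall>j<Suc n. grundy_ext H j \<noteq> a j)"
proof -
  have "finite (a ` {..<Suc n})" by simp
  then obtain M where M: "a j < M" if "j < Suc n" for j
    unfolding finite_nat_set_iff_bounded by blast
  have vM: "v < M" using M[OF i] v by simp
  have a_neq: "M + l \<noteq> a j" if "j < Suc n" for j l using M[OF that] by simp
  \<comment> \<open>If \<open>a n\<close> occurs among the first \<open>n\<close> values, injectivity keeps it away from position \<open>n\<close>.\<close>
  have used_before: "\<exists>H. grundy_ext H i = v \<and> (\<forall>j<Suc n. grundy_ext H j \<noteq> a j)"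
    if b: "inj_on b {..<n}" "\<forall>j<n. b j \<noteq> a j" "b i = v" "i < n" and k: "k < n" "b k = a n"
    for b k
  proof -
    obtain G where G: "G \<noteq> zero_game" "\<forall>j<n. grundy_ext G j = b j"
      using shorter[OF b(1)] by blast
    have "grundy_ext G n \<noteq> a n"
      using grundy_ext_neq_earlier[OF G(1) k(1)] G(2) k by simp
    then have "grundy_ext G j \<noteq> a j" if "j < Suc n" for j
      using that G(2) b(2) by (cases "j = n") simp_all
    then show ?thesis using G(2) b(3,4) by (intro exI[of _ G]) simp
  qed
  \<comment> \<open>If the last value is to be below \<open>a n\<close>, it can be prescribed together with the others.\<close>
  have lower_last: "\<exists>H. grundy_ext H i = v \<and> (\<forall>j<Suc n. grundy_ext H j \<noteq> a j)"
    if b: "inj_on b {..<Suc n}" "\<forall>j<Suc n. b j \<noteq> a j" "b i = v" "b n < a n" for b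
    using smaller_last[OF b(1,4)] b(2,3) i by auto
  consider "i = n" | "i < n" "v = a n" | "i < n" "0 < v" "a n = 0"
    | "i < n" "0 < v" "0 < a n" "v \<noteq> a n" | "i < n" "v = 0" "0 < a n"
    using i by linarith
  then show ?thesis
  proof cases
    case 1
    show ?thesis
      by (rule lower_last[of "\<lambda>j. if j = n then v else M + j"])
        (use 1 v vM a_neq in \<open>auto simp: inj_on_def\<close>)
  next
    case 2
    show ?thesis
      by (rule used_before[of "\<lambda>j. if j = i then v else M + j" i])
        (use 2 v vM a_neq in \<open>auto simp: inj_on_def\<close>)
  next
    case 3
    \<comment> \<open>No last value is below \<open>a n\<close>, and for \<open>n = 1\<close> the only earlier value is \<open>v > 0\<close>, so \<open>0\<close> is
      excluded by inserting an option.  This is possible because all entries of \<open>?b\<close> are positive.\<close>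
    let ?b = "\<lambda>j. if j = i then v else M + j"
    have "inj_on ?b {..<n}" using vM by (auto simp: inj_on_def)
    then obtain G where G: "G \<noteq> zero_game" "\<forall>j<n. grundy_ext G j = ?b j"
      using shorter[of ?b] by blast
    have "0 < grundy_ext G j" if "j < n" for j
      using that G(2) 3 vM by simp
    then obtain G' where G': "\<And>j. j < n \<Longrightarrow> grundy_ext G' j = ?b j" "grundy_ext G' n \<noteq> 0"
      using insert_zero_option[OF G(1), of n] G(2) by metis
    have "grundy_ext G' j \<noteq> a j" if "j < Suc n" for j
      using that G' 3 v a_neq[OF that] by (cases "j = n") auto
    then show ?thesis using G'(1)[of i] 3 by auto
  next
    case 4
    show ?thesis
      by (rule lower_last[of "\<lambda>j. if j = i then v else if j = n then 0 else M + j"])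
        (use 4 v vM a_neq in \<open>auto simp: inj_on_def\<close>)
  next
    case 5
    show ?thesis
    proof (cases "\<exists>k<n. a k = 0")
      case False
      then have "\<forall>j<Suc n. grundy_ext zero_game j \<noteq> a j"
        using 5 by (auto simp: less_Suc_eq)
      then show ?thesis using 5 by (intro exI[of _ zero_game]) simp
    next
      case True
      \<comment> \<open>Position \<open>k\<close> differs from \<open>i\<close>, as \<open>a i > 0\<close>, so it is free to take the value \<open>a n > 0\<close>.\<close>
      then obtain k where k: "k < n" "a k = 0" by blast
      have "k \<noteq> i" using k v by auto
      moreover have "a n < M" using M by simp
      ultimately show ?thesis
        by (intro used_before[of "\<lambda>j. if j = i then 0 else if j = k then a n else M + j" k])
          (use 5 k v a_neq in \<open>auto simp: inj_on_def\<close>)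
    qed
  qed
qed

text \<open>Asking for \<open>G \<noteq> 0\<close> makes \<open>g\<^sub>G\<close> injective, which the induction uses to protect the last
  position, and which makes \<open>s\<^sub>G\<close> finite on the values of \<open>g\<^sub>G\<close>.\<close>

lemma exists_grundy_ext_prescribed:
  assumes "inj_on a {..<n}"
  shows "\<exists>G. G \<noteq> zero_game \<and> (\<forall>i<n. grundy_ext G i = a i)"
  using assms
proof (induction n arbitrary: a)
  case 0
  have "nimber 1 \<noteq> zero_game" by (simp add: nimber_nonzero_iff)
  then show ?case by blast
next
  case (Suc n)
  note shorter = Suc.IH
  show ?case
    using Suc.prems
  proof (induction "a n" arbitrary: a rule: less_induct)
    case less
    show ?case
    proof (rule realise_from_witnesses[OF less.prems])
      fix i v assume i: "i < Suc n" and v: "v < a i"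
      show "\<exists>H. grundy_ext H i = v \<and> (\<forall>j<Suc n. grundy_ext H j \<noteq> a j)"
      proof (rule exists_option_for[of n a, OF _ _ i v])
        fix b :: "nat \<Rightarrow> nat" assume "inj_on b {..<n}"
        then show "\<exists>G. G \<noteq> zero_game \<and> (\<forall>j<n. grundy_ext G j = b j)"
          by (rule shorter)
      next
        fix b assume "inj_on b {..<Suc n}" "b n < a n"
        then show "\<exists>G. G \<noteq> zero_game \<and> (\<forall>j<Suc n. grundy_ext G j = b j)"
          by (rule less.hyps[rotated])
      qed
    qed
  qed
qed

section \<open>The split function as partial inverse of the Grundy function\<close>

lemma split_ext_grundy_ext:
  assumes "G \<noteq> zero_game"
  shows "split_ext G (grundy_ext G m) = enat m"
proof -
  have "P_position (nim_split G (grundy_ext G m) l) \<longleftrightarrow> l = m" for l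
    using inj_eq[OF grundy_ext_inj[OF assms]] grundy_ext_eq_iff[of G l "grundy_ext G m"] by simp
  then show ?thesis unfolding split_ext_def by simp
qed

text \<open>It suffices that \<open>g\<^sub>G\<close> extends the inverse of \<open>a\<close>.  Off the range of \<open>a\<close> its value at \<open>j\<close> is
  taken to be \<open>Suc n + j\<close>, which cannot collide with an index \<open>i \<le> n\<close>.\<close>

lemma exists_split_ext_prescribed:
  assumes inj: "inj_on a {..n}"
  shows "\<exists>G. \<forall>i\<le>n. split_ext G i = enat (a i)"
proof -
  define b where "b j = (if j \<in> a ` {..n} then inv_into {..n} a j else Suc n + j)" for j
  have b_le: "b j \<le> n" if "j \<in> a ` {..n}" for j
    using inv_into_into[OF that] that by (simp add: b_def)
  have b_a: "b (a i) = i" if "i \<le> n" for i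
    using that inj by (simp add: b_def)
  have "inj b"
  proof (rule injI)
    fix x y assume xy: "b x = b y"
    have off: "n < b j" if "j \<notin> a ` {..n}" for j using that by (simp add: b_def)
    consider "x \<in> a ` {..n}" "y \<in> a ` {..n}" | "x \<notin> a ` {..n}" "y \<notin> a ` {..n}"
      using xy b_le off by (metis not_le)
    then show "x = y"
    proof cases
      case 1
      then show ?thesis using xy b_a by auto
    next
      case 2
      then show ?thesis using xy by (simp add: b_def)
    qed
  qed
  have "finite (a ` {..n})" by simp
  then obtain N where N: "a i < N" if "i \<le> n" for i
    unfolding finite_nat_set_iff_bounded by blast
  obtain G where G: "G \<noteq> zero_game" "\<forall>j<N. grundy_ext G j = b j"
    using exists_grundy_ext_prescribed[of b N] inj_on_subset[OF \<open>inj b\<close>] by blast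
  have "split_ext G i = enat (a i)" if "i \<le> n" for i
    using split_ext_grundy_ext[OF G(1), of "a i"] G(2) N[OF that] b_a[OF that] by simp
  then show ?thesis by blast
qed

theorem theorem10:
  shows "(\<forall>(n::nat) (a::nat \<Rightarrow> nat). (\<forall>i\<le>n. \<forall>j\<le>n. i \<noteq> j \<longrightarrow> a i \<noteq> a j) \<longrightarrow>
            (\<exists>G::game. \<forall>i\<le>n. grundy_ext G i = a i)) \<and>
         (\<forall>(n::nat) (a::nat \<Rightarrow> nat). (\<forall>i\<le>n. \<forall>j\<le>n. i \<noteq> j \<longrightarrow> a i \<noteq> a j) \<longrightarrow>
            (\<exists>G::game. \<forall>i\<le>n. split_ext G i = enat (a i)))"
proof (intro conjI allI impI)
  fix n :: nat and a :: "nat \<Rightarrow> nat"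
  assume distinct: "\<forall>i\<le>n. \<forall>j\<le>n. i \<noteq> j \<longrightarrow> a i \<noteq> a j"
  have "inj_on a {..<Suc n}"
    by (rule inj_onI) (use distinct less_Suc_eq_le in blast)
  then show "\<exists>G. \<forall>i\<le>n. grundy_ext G i = a i"
    using exists_grundy_ext_prescribed[of a "Suc n"] less_Suc_eq_le by blast
next
  fix n :: nat and a :: "nat \<Rightarrow> nat"
  assume distinct: "\<forall>i\<le>n. \<forall>j\<le>n. i \<noteq> j \<longrightarrow> a i \<noteq> a j"
  have "inj_on a {..n}"
    by (rule inj_onI) (use distinct in blast)
  then show "\<exists>G. \<forall>i\<le>n. split_ext G i = enat (a i)"
    by (rule exists_split_ext_prescribed)
qed

end
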